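(* The closure $\overline{\Omega}$ of $\Omega$ in $\mathbb{C}$ is path connected.
   Context: Let $m\geq 1$ be an integer, $\beta\in(m,m+1]$ and $E=(E(0),\ldots,E(m))\in\{1,-1\}^{m+1}$. Partition $[0,1]$ into $I_0=[0,1/\beta]$, $I_k=(k/\beta,(k+1)/\beta]$ for $1\leq k\leq m-1$, and $I_m=(m/\beta,1]$. The generalized $\beta$-transformation $f=f_{\beta,E}:[0,1]\to[0,1]$ is given by $f(x)=\beta x-k$ if $x\in I_k$ and $E(k)=1$, and $f(x)=-\beta x+k+1$ if $x\in I_k$ and $E(k)=-1$. It is post-critically finite (PCF) if $\{f^j(1): j\geq 0\}$ is a finite set. A real number $\beta>1$ is a generalized Parry number if there is an $E\in\{1,-1\}^{m+1}$ (where $\beta\in(m,m+1]$) such that $f_{\beta,E}$ is PCF; such a $\beta$ is algebraic. $\Omega\subset\mathbb{C}$ denotes the set of all Galois conjugates of all generalized Parry numbers, where the Galois conjugates of $\beta$ are the complex roots, other than $\beta$ itself, of the minimal polynomial of $\beta$ over $\mathbb{Q}$. *)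

theory Defs
  imports "HOL-Analysis.Analysis" "HOL-Computational_Algebra.Polynomial"
begin

definition branch_interval :: "nat \<Rightarrow> real \<Rightarrow> nat \<Rightarrow> real set" where
  "branch_interval m \<beta> k =
    (if k = 0 then {0..1/\<beta>}
     else if k < m then {real k/\<beta><..(real k + 1)/\<beta>}
     else {real m/\<beta><..1})"

definition branch_index :: "nat \<Rightarrow> real \<Rightarrow> real \<Rightarrow> nat" where
  "branch_index m \<beta> x = (THE k. k \<le> m \<and> x \<in> branch_interval m \<beta> k)"

(* A sign vector (E(0),...,E(m)) is encoded as a function on nat of which only the values at
   0,...,m matter. The map is only meaningful on [0,1], which it maps into itself. *)

definition sign_vector :: "nat \<Rightarrow> (nat \<Rightarrow> int) \<Rightarrow> bool" where
  "sign_vector m E \<longleftrightarrow> (\<forall>k\<le>m. E k \<in> {1, -1})"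

definition gen_beta_map :: "nat \<Rightarrow> real \<Rightarrow> (nat \<Rightarrow> int) \<Rightarrow> real \<Rightarrow> real" where
  "gen_beta_map m \<beta> E x =
    (let k = branch_index m \<beta> x
     in if E k = 1 then \<beta> * x - real k else - \<beta> * x + real k + 1)"

definition pcf :: "(real \<Rightarrow> real) \<Rightarrow> bool" where
  "pcf f \<longleftrightarrow> finite {(f ^^ j) 1 | j. True}"

definition generalized_Parry :: "real \<Rightarrow> bool" where
  "generalized_Parry \<beta> \<longleftrightarrow>
    (\<exists>m::nat. m \<ge> 1 \<and> \<beta> \<in> {real m<..real m + 1} \<and>
      (\<exists>E. sign_vector m E \<and> pcf (gen_beta_map m \<beta> E)))"

definition is_minimal_poly :: "rat poly \<Rightarrow> complex \<Rightarrow> bool" where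
  "is_minimal_poly p x \<longleftrightarrow>
    lead_coeff p = 1 \<and> poly (map_poly of_rat p) x = 0 \<and>
    (\<forall>q. q \<noteq> 0 \<longrightarrow> poly (map_poly of_rat q) x = 0 \<longrightarrow> degree p \<le> degree q)"

definition Galois_conjugates :: "complex \<Rightarrow> complex set" where
  "Galois_conjugates x =
    {z. z \<noteq> x \<and> (\<exists>p. is_minimal_poly p x \<and> poly (map_poly of_rat p) z = 0)}"

definition Omega :: "complex set" where
  "Omega = (\<Union>\<beta>\<in>{\<beta>. generalized_Parry \<beta>}. Galois_conjugates (of_real \<beta>))"


lemma branch_index_unique:
  assumes "m \<ge> 1" "\<beta> \<in> {real m<..real m + 1}" "x \<in> {0..1}"
  shows "\<exists>!k. k \<le> m \<and> x \<in> branch_interval m \<beta> k"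
proof -
  have b: "\<beta> > 0" using assms by auto
  have iff: "x \<in> branch_interval m \<beta> k \<longleftrightarrow>
      (k = 0 \<and> \<beta> * x \<le> 1) \<or> (k > 0 \<and> real k < \<beta> * x \<and> (k = m \<or> \<beta> * x \<le> real k + 1))"
    if "k \<le> m" for k
    using that assms b
    by (auto simp: branch_interval_def field_simps)
  have le: "\<beta> * x \<le> real m + 1"
  proof -
    have "\<beta> * x \<le> \<beta> * 1" using b assms by (intro mult_left_mono) auto
    then show ?thesis using assms(2) unfolding greaterThanAtMost_iff by linarith
  qed
  define k0 where "k0 = (if \<beta> * x \<le> 1 then 0 else nat (\<lceil>\<beta> * x\<rceil> - 1))"
  have "k0 \<le> m \<and> x \<in> branch_interval m \<beta> k0"
  proof (cases "\<beta> * x \<le> 1")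
    case True
    then show ?thesis using iff[of 0] by (simp add: k0_def)
  next
    case False
    have c: "\<lceil>\<beta> * x\<rceil> \<ge> 2" "\<lceil>\<beta> * x\<rceil> \<le> int m + 1" using False le by linarith+
    have r: "real k0 = of_int \<lceil>\<beta> * x\<rceil> - 1" using False c by (simp add: k0_def)
    have "k0 > 0" "k0 \<le> m" using False c by (auto simp: k0_def)
    moreover have "real k0 < \<beta> * x" "\<beta> * x \<le> real k0 + 1" using r by linarith+
    ultimately show ?thesis using iff by auto
  qed
  moreover have "j = k" if "j \<le> m \<and> x \<in> branch_interval m \<beta> j" "k \<le> m \<and> x \<in> branch_interval m \<beta> k" for j k
    using that iff[of j] iff[of k] le by (auto; linarith)
  ultimately show ?thesis by blast
qed

lemma gen_beta_map_eq:
  assumes "m \<ge> 1" "\<beta> \<in> {real m<..real m + 1}" "x \<in> {0..1}"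
    and "k \<le> m" "x \<in> branch_interval m \<beta> k"
  shows "gen_beta_map m \<beta> E x = (if E k = 1 then \<beta> * x - real k else - \<beta> * x + real k + 1)"
proof -
  have "branch_index m \<beta> x = k"
    unfolding branch_index_def
    by (rule the1_equality[OF branch_index_unique[OF assms(1-3)]]) (use assms in auto)
  then show ?thesis by (simp add: gen_beta_map_def)
qed

lemma gen_beta_map_in_unit:
  assumes "m \<ge> 1" "\<beta> \<in> {real m<..real m + 1}" "x \<in> {0..1}"
  shows "gen_beta_map m \<beta> E x \<in> {0..1}"
proof -
  obtain k where k: "k \<le> m" "x \<in> branch_interval m \<beta> k"
    using branch_index_unique[OF assms] by blast
  have b: "\<beta> > 0" using assms by auto
  have "\<beta> * x \<le> \<beta> * 1" "\<beta> * x \<ge> 0" using b assms by (auto intro: mult_left_mono)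
  then have "\<beta> * x \<le> real m + 1" "\<beta> * x \<ge> 0"
    using assms(2) unfolding greaterThanAtMost_iff by linarith+
  then have "real k \<le> \<beta> * x \<and> \<beta> * x \<le> real k + 1"
    using k assms b by (auto simp: branch_interval_def field_simps split: if_splits)
  then show ?thesis using gen_beta_map_eq[OF assms k] by auto
qed

lemma is_minimal_poly_unique:
  assumes "is_minimal_poly p x" "is_minimal_poly q x"
  shows "p = q"
proof (rule ccontr)
  assume ne: "p \<noteq> q"
  have deg: "degree p = degree q"
  proof (rule antisym)
    have "p \<noteq> 0" "q \<noteq> 0" using assms by (auto simp: is_minimal_poly_def)
    then show "degree p \<le> degree q" "degree q \<le> degree p"
      using assms by (auto simp: is_minimal_poly_def)
  qed
  have sub: "map_poly of_rat (p - q) = (map_poly of_rat p - map_poly of_rat q :: complex poly)"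
    by (rule poly_eqI) (simp add: coeff_map_poly of_rat_diff)
  have "poly (map_poly of_rat (p - q)) x = 0"
    using assms by (simp add: sub is_minimal_poly_def)
  then have "degree p \<le> degree (p - q)" using assms ne by (simp add: is_minimal_poly_def)
  moreover have "coeff (p - q) (degree p) = 0" using assms deg by (simp add: is_minimal_poly_def)
  moreover have "degree (p - q) \<le> degree p" using deg by (simp add: degree_diff_le)
  ultimately have "lead_coeff (p - q) = 0" by simp
  then show False using ne leading_coeff_0_iff[of "p - q"] by (simp del: coeff_diff leading_coeff_0_iff)
qed

end

(* The closure of Omega is star-shaped about 0. Call z a unit box root if it is a root of a monic real
   polynomial with coefficients in [-1,1].

   If z is a conjugate of beta and x_j is the orbit of 1, then sigma_j x_j = U_j(beta) for a monic integer
   polynomial U_j and a sign sigma_j. If x_i = x_j, then sigma_i U_i - sigma_j U_j vanishes at beta,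
   hence at z, so the finiteness of the orbit makes U_n(z) bounded. As U_n(z) - U_n(beta) is z - beta
   times the sum of y_j z^(n-1-j) with y_j = sigma_j x_j in [-1,1], these sums are bounded too; for
   0 < t < 1 the coefficients t^j y_j then give a value at tz that tends to 0, and a change of the last
   two coefficients makes it exactly 0. So tz is a unit box root.

   Conversely let z be a root of X^n + a_1 X^(n-1) + ... + a_n with a_j in [-1,1]. For a large even M,
   choose even integers c_j close to -M a_j with c_0 = -M and c_n = 2 mod 4. The large root beta of
   X^(n+1) + c_0 X^n + ... + c_n gives points y_(j+1) = beta y_j + c_j close to a_(j+1) with y_(n+1) = 0,
   and for a suitable sign vector the |y_j| form the orbit of 1. The cofactor of X - beta is close to
   the given polynomial, so it has a root near z, which is a conjugate of beta by Eisenstein's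
   criterion. Hence z lies in the closure of Omega. *)
theory Submission
  imports Defs "HOL-Computational_Algebra.Fundamental_Theorem_Algebra"
begin

subsection \<open>Eisenstein's criterion and minimal polynomials\<close>

lemma of_int_poly_mult:
  "map_poly of_int (p * q) = (map_poly of_int p * map_poly of_int q :: 'a::comm_ring_1 poly)"
  by (rule poly_eqI) (simp add: coeff_map_poly coeff_mult)

lemma of_rat_poly_add:
  "map_poly of_rat (p + q) = (map_poly of_rat p + map_poly of_rat q :: 'a::field_char_0 poly)"
  by (rule poly_eqI) (simp add: coeff_map_poly of_rat_add)

lemma of_rat_poly_mult:
  "map_poly of_rat (p * q) = (map_poly of_rat p * map_poly of_rat q :: 'a::field_char_0 poly)"
  by (rule poly_eqI) (simp add: coeff_map_poly coeff_mult of_rat_sum of_rat_mult)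

lemma clear_denominators:
  fixes p :: "rat poly"
  obtains d q where "d \<noteq> 0" "smult (of_int d) p = map_poly of_int q"
proof -
  have "\<exists>d q. d \<noteq> 0 \<and> smult (of_int d) p = map_poly of_int q"
  proof (induction p)
    case 0
    show ?case by (intro exI[of _ 1] exI[of _ 0]) simp
  next
    case (pCons a p)
    then obtain d q where dq: "d \<noteq> 0" "smult (of_int d) p = map_poly of_int q" by blast
    obtain u v where uv: "a = of_int u / of_int v" "v > (0::int)"
      by (metis quotient_of_div quotient_of_denom_pos surj_pair)
    have "smult (of_int (v * d)) (pCons a p) = map_poly of_int (pCons (d * u) (smult v q))"
    proof -
      have "smult (of_int (v * d)) p = smult (of_int v) (smult (of_int d) p)" by simp
      also have "\<dots> = map_poly of_int (smult v q)"
        unfolding dq by (rule poly_eqI) (simp add: coeff_map_poly)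
      finally show ?thesis using uv by (simp add: map_poly_pCons)
    qed
    moreover have "v * d \<noteq> 0" using dq uv by simp
    ultimately show ?case by blast
  qed
  then show thesis using that by blast
qed

text \<open>For nonconstant \<open>S\<close> every index up to \<open>degree R\<close> lies below
  \<open>degree (R * S)\<close>, and comparing coefficients of the product shows inductively that
  \<open>p\<close> divides each coefficient of \<open>R\<close>, even the leading one.\<close>

lemma eisenstein_factor:
  fixes R S :: "'a::idom poly"
  assumes p: "prime_elem p"
    and low: "\<And>i. i < degree (R * S) \<Longrightarrow> p dvd coeff (R * S) i"
    and lead: "\<not> p dvd lead_coeff (R * S)"
    and R0: "p dvd coeff R 0" and S0: "\<not> p dvd coeff S 0"
  shows "degree S = 0"
proof (rule ccontr)
  assume S: "degree S \<noteq> 0"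
  have "R * S \<noteq> 0" using lead by auto
  then have deg: "degree (R * S) = degree R + degree S"
    by (metis degree_mult_eq mult_zero_left mult_zero_right)
  have "p dvd coeff R i" if "i \<le> degree R" for i
    using that
  proof (induction i rule: less_induct)
    case (less i)
    show ?case
    proof (cases "i = 0")
      case True
      then show ?thesis using R0 by simp
    next
      case False
      have "coeff (R * S) i = (\<Sum>j<i. coeff R j * coeff S (i - j)) + coeff R i * coeff S 0"
        by (simp add: coeff_mult lessThan_Suc_atMost [symmetric])
      moreover have "p dvd (\<Sum>j<i. coeff R j * coeff S (i - j))"
        using less by (intro dvd_sum dvd_mult2) auto
      moreover have "p dvd coeff (R * S) i"
        using less.prems S deg by (intro low) simp
      ultimately have "p dvd coeff R i * coeff S 0"
        by (simp add: dvd_add_right_iff)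
      then show ?thesis using p S0 by (simp add: prime_elem_dvd_mult_iff)
    qed
  qed
  then have "p dvd lead_coeff R" by blast
  then show False using lead by (simp add: lead_coeff_mult)
qed

text \<open>Unless the product is constant, \<open>p\<close> divides exactly one of the two constant
  coefficients, since its square does not divide their product. The factor carrying the other one is
  then constant.\<close>

lemma eisenstein_criterion:
  fixes R S :: "'a::idom poly"
  assumes p: "prime_elem p"
    and low: "\<And>i. i < degree (R * S) \<Longrightarrow> p dvd coeff (R * S) i"
    and lead: "\<not> p dvd lead_coeff (R * S)"
    and const: "\<not> p\<^sup>2 dvd coeff (R * S) 0"
  shows "degree R = 0 \<or> degree S = 0"
proof (cases "degree (R * S) = 0")
  case True
  have "R * S \<noteq> 0" using lead by auto
  then have "degree (R * S) = degree R + degree S"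
    by (metis degree_mult_eq mult_zero_left mult_zero_right)
  then show ?thesis using True by simp
next
  case False
  have eq: "coeff (R * S) 0 = coeff R 0 * coeff S 0" by (simp add: coeff_mult)
  have "p dvd coeff R 0 * coeff S 0" using low[of 0] False eq by simp
  moreover have "\<not> (p dvd coeff R 0 \<and> p dvd coeff S 0)"
    using const eq by (metis mult_dvd_mono power2_eq_square)
  ultimately consider "p dvd coeff R 0" "\<not> p dvd coeff S 0" | "p dvd coeff S 0" "\<not> p dvd coeff R 0"
    using p by (auto simp: prime_elem_dvd_mult_iff)
  then show ?thesis
  proof cases
    case 1
    then have "degree S = 0" using low lead by (intro eisenstein_factor[OF p, of R S]) auto
    then show ?thesis by simp
  next
    case 2
    then have "degree R = 0"
      using low lead eisenstein_factor[OF p, of S R] unfolding mult.commute[of S R] by metis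
    then show ?thesis by simp
  qed
qed

lemma is_minimal_poly_dvd:
  assumes p: "is_minimal_poly p x" and q: "poly (map_poly of_rat q) x = 0"
  shows "p dvd q"
proof -
  have p0: "p \<noteq> 0" using p by (auto simp: is_minimal_poly_def)
  have "q = q div p * p + q mod p" by simp
  then have "poly (map_poly of_rat q) x = poly (map_poly of_rat (q div p)) x * poly (map_poly of_rat p) x
     + poly (map_poly of_rat (q mod p)) x"
    by (metis of_rat_poly_add of_rat_poly_mult poly_add poly_mult)
  then have "poly (map_poly of_rat (q mod p)) x = 0"
    using p q by (simp add: is_minimal_poly_def)
  moreover have "q mod p = 0 \<or> degree (q mod p) < degree p"
    using p0 by (rule degree_mod_less)
  ultimately have "q mod p = 0" using p by (force simp: is_minimal_poly_def)
  then show ?thesis by auto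
qed

text \<open>Divisibility by the minimal polynomial carries every rational relation from
  \<open>x\<close> to its conjugates; this is how coincidences in the orbit of 1 reach
  \<open>z\<close>.\<close>

lemma Galois_conjugates_root:
  assumes "z \<in> Galois_conjugates x" "poly (map_poly of_rat q) x = 0"
  shows "poly (map_poly of_rat q) z = 0"
proof -
  obtain p where p: "is_minimal_poly p x" "poly (map_poly of_rat p) z = 0"
    using assms by (auto simp: Galois_conjugates_def)
  obtain r where "q = p * r" using is_minimal_poly_dvd[OF p(1) assms(2)] by blast
  then show ?thesis using p by (simp add: of_rat_poly_mult)
qed

lemma is_minimal_poly_exists:
  assumes "q \<noteq> 0" "poly (map_poly of_rat q) x = 0"
  obtains p where "is_minimal_poly p x"
proof -
  define P where "P = (\<lambda>p. p \<noteq> 0 \<and> poly (map_poly of_rat p) x = 0)"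
  obtain p where p: "P p" "\<And>r. P r \<Longrightarrow> degree p \<le> degree r"
    using arg_min_nat_lemma[of P q degree] assms by (auto simp: P_def)
  define c where "c = lead_coeff p"
  have c: "c \<noteq> 0" using p by (simp add: c_def P_def)
  have "map_poly of_rat (smult (inverse c) p) = smult (of_rat (inverse c)) (map_poly of_rat p :: complex poly)"
    by (rule poly_eqI) (simp add: coeff_map_poly of_rat_mult)
  then have "is_minimal_poly (smult (inverse c) p) x"
    using p c by (auto simp: is_minimal_poly_def P_def c_def)
  then show thesis by (rule that)
qed

text \<open>If \<open>r\<close> is the minimal polynomial and \<open>s\<close> its cofactor, Gauss's
  lemma turns \<open>r * s\<close> into an integer factorization of \<open>Q\<close> up to sign with
  the same degrees, and Eisenstein's criterion forces \<open>s\<close> to be constant.\<close>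

lemma eisenstein_minimal_poly:
  fixes Q :: "int poly"
  assumes p: "prime p"
    and monic: "lead_coeff Q = 1"
    and low: "\<And>i. i < degree Q \<Longrightarrow> p dvd coeff Q i"
    and const: "\<not> p\<^sup>2 dvd coeff Q 0"
    and root: "poly (map_poly of_int Q) x = 0"
  shows "is_minimal_poly (map_poly of_int Q) x"
proof -
  define Qr where "Qr = (map_poly of_int Q :: rat poly)"
  have Qr_root: "poly (map_poly of_rat Qr) x = 0"
    using root by (simp add: Qr_def map_poly_map_poly o_def)
  have Qr_lead: "lead_coeff Qr = 1" and Qr_deg: "degree Qr = degree Q"
    using monic by (simp_all add: Qr_def degree_map_poly coeff_map_poly)
  then have Qr0: "Qr \<noteq> 0" by auto
  obtain r where r: "is_minimal_poly r x" using is_minimal_poly_exists[OF Qr0 Qr_root] .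
  obtain s where s: "Qr = r * s" using is_minimal_poly_dvd[OF r Qr_root] by blast
  have r0: "r \<noteq> 0" and s0: "s \<noteq> 0" using s Qr0 by auto
  obtain a R where aR: "a \<noteq> 0" "smult (of_int a) r = map_poly of_int R" by (rule clear_denominators)
  obtain b S where bS: "b \<noteq> 0" "smult (of_int b) s = map_poly of_int S" by (rule clear_denominators)
  have "map_poly of_int (R * S) = smult (of_int (a * b)) Qr"
    unfolding of_int_poly_mult aR(2)[symmetric] bS(2)[symmetric] s by (simp add: mult.commute)
  then have "(of_int (coeff (R * S) i) :: rat) = of_int (coeff (smult (a * b) Q) i)" for i
    by (metis (no_types, lifting) Qr_def coeff_map_poly coeff_smult of_int_0 of_int_mult)
  then have RS: "R * S = smult (a * b) Q" by (intro poly_eqI) (metis of_int_eq_iff)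
  have cQ: "content Q = 1"
    by (metis content_dvd_coeff is_unit_content_iff monic)
  \<comment> \<open>The content is multiplicative and \<open>Q\<close> has content 1, so the
    contents of \<open>R\<close> and \<open>S\<close> account for all of
    \<open>\<bar>a * b\<bar>\<close> and can be cancelled.\<close>
  have "content R * content S = content (R * S)" by (simp add: content_mult)
  also have "\<dots> = \<bar>a * b\<bar>" unfolding RS by (simp add: cQ)
  finally have cc: "content R * content S = \<bar>a * b\<bar>" .
  have "smult \<bar>a * b\<bar> (primitive_part R * primitive_part S) =
      smult (content R) (primitive_part R) * smult (content S) (primitive_part S)"
    by (simp add: cc[symmetric] mult_ac del: content_times_primitive_part)
  also have "\<dots> = smult \<bar>a * b\<bar> (smult (sgn (a * b)) Q)"
    by (simp add: RS abs_mult_sgn)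
  finally have eq: "primitive_part R * primitive_part S = smult (sgn (a * b)) Q" (is "?R * ?S = _")
    using aR(1) bS(1) by (metis abs_eq_0 mult_eq_0_iff smult_cancel)
  have sg: "sgn (a * b) = 1 \<or> sgn (a * b) = -1" using aR(1) bS(1) by (auto simp: sgn_if)
  have "degree ?R = 0 \<or> degree ?S = 0"
  proof (rule eisenstein_criterion)
    show "prime_elem p" using p by (rule prime_imp_prime_elem)
    show "p dvd coeff (?R * ?S) i" if "i < degree (?R * ?S)" for i
      using that low sg unfolding eq by auto
    show "\<not> p dvd lead_coeff (?R * ?S)"
      using sg monic p unfolding eq by (auto simp: not_prime_unit)
    show "\<not> p\<^sup>2 dvd coeff (?R * ?S) 0"
      using sg const unfolding eq by auto
  qed
  then have "degree R = 0 \<or> degree S = 0" by simp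
  moreover have "degree R = degree r"
  proof -
    have "degree (map_poly of_int R :: rat poly) = degree R" by (rule degree_map_poly) simp
    then show ?thesis using aR by (metis degree_smult_eq of_int_eq_0_iff)
  qed
  moreover have "degree S = degree s"
  proof -
    have "degree (map_poly of_int S :: rat poly) = degree S" by (rule degree_map_poly) simp
    then show ?thesis using bS by (metis degree_smult_eq of_int_eq_0_iff)
  qed
  \<comment> \<open>A nonzero constant has no root, so the constant factor can only be
    \<open>s\<close>.\<close>
  moreover have "degree r \<noteq> 0"
  proof
    assume "degree r = 0"
    then obtain u where "r = [:u:]" by (rule degree_eq_zeroE)
    then show False using r by (auto simp: is_minimal_poly_def map_poly_pCons)
  qed
  ultimately have "degree s = 0" by auto
  then have "degree r = degree Qr" using r0 s0 s by (simp add: degree_mult_eq)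
  then show ?thesis
    using r Qr_lead Qr_root unfolding Qr_def[symmetric] is_minimal_poly_def by auto
qed

subsection \<open>Polynomials given by linear recurrences\<close>

text \<open>This is X^j + c_0 X^(j-1) + ... + c_(j-1): each step multiplies by X and appends
  \<open>c j\<close> as constant term, so the values at z obey Y_(j+1) = z Y_j + c_j with Y_0 =
  1.\<close>

primrec horner :: "(nat \<Rightarrow> 'a::comm_ring_1) \<Rightarrow> nat \<Rightarrow> 'a poly" where
  "horner c 0 = 1"
| "horner c (Suc j) = pCons (c j) (horner c j)"

lemma horner_monic: "degree (horner c j) = j \<and> lead_coeff (horner c j) = 1"
  by (induction j) auto

lemma coeff_horner: "i < n \<Longrightarrow> coeff (horner c n) i = c (n - Suc i)"
proof (induction n arbitrary: i)
  case (Suc n)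
  then show ?case by (cases i) auto
qed simp

lemma poly_horner_sum: "poly (horner c n) z = z ^ n + (\<Sum>j<n. c j * z ^ (n - Suc j))"
proof (induction n)
  case (Suc n)
  have "(\<Sum>j<n. c j * z ^ (n - j)) = z * (\<Sum>j<n. c j * z ^ (n - Suc j))"
    unfolding sum_distrib_left
    by (intro sum.cong) (auto simp: Suc_diff_Suc[symmetric] mult_ac simp del: diff_Suc_Suc)
  then show ?case using Suc by (simp add: algebra_simps)
qed simp

text \<open>The \<open>c j\<close> cancel in D_j = Y_j - y_j, leaving D_(j+1) = z D_j + (z - b) y_j.
  This is synthetic division by z - b: the \<open>y i\<close> are the coefficients of the quotient
  and \<open>y n\<close> is the remainder.\<close>

lemma recurrence_quotient:
  fixes Y y c :: "nat \<Rightarrow> 'a::comm_ring_1"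
  assumes "Y 0 = 1" "y 0 = 1"
    and "\<And>j. j < n \<Longrightarrow> Y (Suc j) = z * Y j + c j"
    and "\<And>j. j < n \<Longrightarrow> y (Suc j) = b * y j + c j"
  shows "Y n - y n = (z - b) * (\<Sum>i<n. y i * z ^ (n - Suc i))"
  using assms
proof (induction n)
  case (Suc n)
  define S where "S = (\<Sum>i<n. y i * z ^ (n - Suc i))"
  have "(\<Sum>i<n. y i * z ^ (n - i)) = z * S"
    unfolding S_def sum_distrib_left
    by (intro sum.cong) (auto simp: Suc_diff_Suc[symmetric] mult_ac simp del: diff_Suc_Suc)
  then have sum: "(\<Sum>i<Suc n. y i * z ^ (Suc n - Suc i)) = z * S + y n" by simp
  have Y: "Y n = y n + (z - b) * S"
    using Suc unfolding S_def by (simp add: diff_eq_eq add.commute)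
  have "Y (Suc n) - y (Suc n) = z * Y n - b * y n"
    using Suc.prems(3,4)[of n] by simp
  also have "\<dots> = (z - b) * (z * S + y n)" unfolding Y by (simp add: algebra_simps)
  finally show ?case unfolding sum .
qed simp

text \<open>For monic \<open>p\<close> the norm of \<open>poly p z\<close> is the product of the
  distances from \<open>z\<close> to the roots, so they cannot all be at least
  \<open>e\<close>.\<close>

lemma monic_root_near:
  fixes p :: "complex poly"
  assumes "lead_coeff p = 1" "degree p > 0" "e > 0" "norm (poly p z) < e ^ degree p"
  obtains r where "poly p r = 0" "dist r z < e"
proof -
  obtain root where r: "smult (lead_coeff p) (\<Prod>i<degree p. [:-root i, 1:]) = p"
    by (rule complex_poly_decompose')
  have eq: "poly p w = (\<Prod>i<degree p. w - root i)" for w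
    by (subst r[symmetric]) (simp add: assms(1) poly_prod)
  have "\<exists>i<degree p. norm (z - root i) < e"
  proof (rule ccontr)
    assume "\<not> ?thesis"
    then have "(\<Prod>i<degree p. e) \<le> (\<Prod>i<degree p. norm (z - root i))"
      using assms(3) by (intro prod_mono) auto
    then show False using assms(4) by (simp add: eq prod_norm)
  qed
  then obtain i where "i < degree p" "norm (z - root i) < e" by blast
  then show thesis using that[of "root i"] by (auto simp: eq dist_norm norm_minus_commute)
qed

subsection \<open>Scaled conjugates are unit box roots\<close>

text \<open>Coefficients are indexed from the leading one downwards, the order in which an orbit
  supplies them. The case \<open>n = 0\<close> cannot occur, as the sum would equal 1.\<close>

definition unit_box_root :: "complex \<Rightarrow> bool" where
  "unit_box_root z \<longleftrightarrow> (\<exists>n a. a 0 = 1 \<and> (\<forall>j\<le>n. \<bar>a j\<bar> \<le> 1) \<and>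
     (\<Sum>j\<le>n. of_real (a j) * z ^ (n - j)) = 0)"

text \<open>For nonreal \<open>w\<close>, 1 and \<open>w\<close> form a real basis of the complex
  plane, and the coordinates of \<open>e\<close> are linear in \<open>e\<close>. For real
  \<open>w\<close>, \<open>r = 0\<close> works and the denominator defaults to 1. This serves to
  correct the last two coefficients of a polynomial.\<close>

lemma real_span_small:
  fixes w e :: complex
  assumes "w \<in> \<real> \<Longrightarrow> e \<in> \<real>"
  obtains r s where "of_real r * w + of_real s = e"
    "\<bar>r\<bar> \<le> norm e / (if Im w = 0 then 1 else \<bar>Im w\<bar>)"
    "\<bar>s\<bar> \<le> norm e * (1 + norm w / (if Im w = 0 then 1 else \<bar>Im w\<bar>))"
proof (cases "Im w = 0")
  case True
  then have "Im e = 0" using assms by (simp add: complex_is_Real_iff)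
  then have "e = of_real (Re e)" by (simp add: complex_eq_iff)
  moreover have "\<bar>Re e\<bar> \<le> norm e * (1 + norm w)"
    using abs_Re_le_cmod[of e] by (simp add: algebra_simps add_increasing2)
  ultimately show thesis using True that[of 0 "Re e"] by simp
next
  case False
  define r where "r = Im e / Im w"
  define s where "s = Re e - r * Re w"
  have "of_real r * w + of_real s = e"
    using False by (simp add: complex_eq_iff r_def s_def)
  moreover have r: "\<bar>r\<bar> \<le> norm e / \<bar>Im w\<bar>"
    using abs_Im_le_cmod[of e] by (simp add: r_def divide_right_mono)
  moreover have "\<bar>s\<bar> \<le> norm e * (1 + norm w / \<bar>Im w\<bar>)"
  proof -
    have "\<bar>s\<bar> \<le> \<bar>Re e\<bar> + \<bar>r\<bar> * \<bar>Re w\<bar>"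
      unfolding s_def by (metis abs_mult abs_triangle_ineq4)
    also have "\<dots> \<le> norm e + (norm e / \<bar>Im w\<bar>) * norm w"
      by (intro add_mono mult_mono r abs_Re_le_cmod) auto
    finally show ?thesis by (simp add: algebra_simps)
  qed
  ultimately show thesis using False that[of r s] by simp
qed

text \<open>Scaling \<open>z\<close> by \<open>t\<close> multiplies the j-th coefficient by
  \<open>t ^ j\<close>, so all but the first have size at most \<open>t\<close>. This leaves room
  \<open>1 - t\<close> for cancelling the value at the scaled point, which tends to 0.\<close>

lemma unit_box_root_of_bounded:
  fixes y :: "nat \<Rightarrow> real"
  assumes y0: "y 0 = 1" and y: "\<And>j. \<bar>y j\<bar> \<le> 1"
    and bound: "\<And>n. norm (\<Sum>i<n. of_real (y i) * z ^ (n - Suc i)) \<le> C"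
    and t: "0 < t" "t < 1"
  shows "unit_box_root (of_real t * z)"
proof -
  define w where "w = of_real t * z"
  define V where "V n = (\<Sum>i\<le>n. of_real (y i) * z ^ (n - i))" for n
  define d where "d = (if Im w = 0 then 1 else \<bar>Im w\<bar>)"
  have d: "d > 0" by (simp add: d_def)
  have V: "norm (V n) \<le> C" for n
    using bound[of "Suc n"] by (simp add: V_def lessThan_Suc_atMost)
  \<comment> \<open>\<open>t ^ n * K\<close> bounds the sum of the two corrections \<open>r\<close>
    and \<open>s\<close> below.\<close>
  define K where "K = C * (1 / d + (1 + norm w / d))"
  have C: "C \<ge> 0" using bound[of 0] by simp
  have "(\<lambda>n. t ^ n * K) \<longlonglongrightarrow> 0 * K"
    using t by (intro tendsto_mult LIMSEQ_realpow_zero tendsto_const) auto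
  then have "eventually (\<lambda>n. t ^ n * K < 1 - t) sequentially"
    using t by (intro order_tendstoD(2)) auto
  then obtain N where N: "\<And>n. n \<ge> N \<Longrightarrow> t ^ n * K < 1 - t"
    by (auto simp: eventually_sequentially)
  \<comment> \<open>As \<open>n\<close> is at least 2, correcting the indices \<open>n - 1\<close>
    and \<open>n\<close> leaves the leading coefficient \<open>a 0\<close> alone.\<close>
  define n where "n = Suc (Suc N)"
  have small: "t ^ n * K < 1 - t" using N[of n] by (simp add: n_def)
  define e where "e = - (of_real t ^ n * V n)"
  have ne: "norm e \<le> t ^ n * C"
    using V[of n] t by (simp add: e_def norm_mult norm_power mult_left_mono)
  have "e \<in> \<real>" if "w \<in> \<real>"
  proof -
    have "z = w / of_real t" using t by (simp add: w_def)
    then have "z \<in> \<real>" using that by auto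
    then show ?thesis by (auto simp: e_def V_def)
  qed
  then obtain r s where rs: "of_real r * w + of_real s = e" "\<bar>r\<bar> \<le> norm e / d"
      "\<bar>s\<bar> \<le> norm e * (1 + norm w / d)"
    using real_span_small[of w e] unfolding d_def by blast
  have "norm e / d \<le> t ^ n * C / d" "norm e * (1 + norm w / d) \<le> t ^ n * C * (1 + norm w / d)"
    using ne d by (auto intro!: divide_right_mono mult_right_mono)
  moreover have "t ^ n * C / d + t ^ n * C * (1 + norm w / d) < 1 - t"
    using small by (simp add: K_def algebra_simps)
  moreover have "t ^ n * C / d \<ge> 0" "t ^ n * C * (1 + norm w / d) \<ge> 0"
    using t C d by (auto intro!: divide_nonneg_pos mult_nonneg_nonneg add_nonneg_nonneg)
  ultimately have rs': "\<bar>r\<bar> \<le> 1 - t" "\<bar>s\<bar> \<le> 1 - t" using rs by linarith+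
  define a where "a j = t ^ j * y j + (if j = n - 1 then r else 0) + (if j = n then s else 0)" for j
  have "a 0 = 1" by (simp add: a_def y0 n_def)
  moreover have "\<bar>a j\<bar> \<le> 1" for j
  proof (cases "j = 0")
    case True
    then show ?thesis using \<open>a 0 = 1\<close> by simp
  next
    case False
    have "\<bar>t ^ j * y j\<bar> \<le> t ^ j * 1"
      using t y[of j] by (simp add: abs_mult mult_left_le)
    also have "\<dots> \<le> t" using t False power_decreasing[of 1 j t] by simp
    finally have "\<bar>t ^ j * y j\<bar> \<le> t" .
    then show ?thesis using rs' t by (auto simp: a_def n_def)
  qed
  moreover have "(\<Sum>j\<le>n. of_real (a j) * w ^ (n - j)) = 0"
  proof -
    have "(\<Sum>j\<le>n. of_real (a j) * w ^ (n - j)) =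
        (\<Sum>j\<le>n. of_real (t ^ j * y j) * w ^ (n - j))
        + (\<Sum>j\<le>n. if j = n - 1 then of_real r * w else 0) + (\<Sum>j\<le>n. if j = n then of_real s else 0)"
      unfolding sum.distrib[symmetric] by (intro sum.cong) (auto simp: a_def n_def algebra_simps)
    also have "(\<Sum>j\<le>n. of_real (t ^ j * y j) * w ^ (n - j)) = of_real t ^ n * V n"
      unfolding V_def sum_distrib_left
      by (intro sum.cong) (auto simp: w_def power_mult_distrib power_add[symmetric])
    also have "\<dots> + (\<Sum>j\<le>n. if j = n - 1 then of_real r * w else 0) + (\<Sum>j\<le>n. if j = n then of_real s else 0)
       = of_real t ^ n * V n + (of_real r * w + of_real s)"
      by (simp add: n_def)
    finally show ?thesis by (simp add: rs e_def)
  qed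
  ultimately show ?thesis unfolding unit_box_root_def w_def by blast
qed

lemma Omega_scaled:
  assumes z: "z \<in> Omega" and t: "0 < t" "t < 1"
  shows "unit_box_root (of_real t * z)"
proof -
  obtain \<beta> m E where gc: "z \<in> Galois_conjugates (of_real \<beta>)" and m: "m \<ge> 1" "\<beta> \<in> {real m<..real m + 1}"
    and pcf: "pcf (gen_beta_map m \<beta> E)"
    using z by (auto simp: Omega_def generalized_Parry_def)
  have zb: "z \<noteq> of_real \<beta>" using gc by (simp add: Galois_conjugates_def)
  define f where "f = gen_beta_map m \<beta> E"
  define x where "x j = (f ^^ j) 1" for j
  define k where "k j = branch_index m \<beta> (x j)" for j
  define s where "s j = (if E (k j) = 1 then 1 else (-1::int))" for j
  define d where "d j = (if E (k j) = 1 then - int (k j) else int (k j) + 1)" for j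
  have x_Suc: "x (Suc j) = of_int (s j) * \<beta> * x j + of_int (d j)" for j
    by (simp add: x_def f_def gen_beta_map_def Let_def s_def d_def k_def)
  have x_range: "x j \<in> {0..1}" for j
  proof (induction j)
    case (Suc j)
    then show ?case using gen_beta_map_in_unit[OF m, of "x j" E] by (simp add: x_def f_def)
  qed (simp add: x_def)
  have fin: "finite (range x)"
  proof -
    have "range x = {(f ^^ j) 1 | j. True}" by (auto simp: x_def)
    then show ?thesis using pcf by (simp add: pcf_def f_def)
  qed
  \<comment> \<open>The cumulative signs absorb the \<open>s j\<close>: the signed orbit
    \<open>y\<close> has the multiplier \<beta> at every step.\<close>
  define \<sigma> where "\<sigma> j = (\<Prod>i<j. s i)" for j
  have \<sigma>: "\<sigma> j = 1 \<or> \<sigma> j = -1" for j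
    by (induction j) (auto simp: \<sigma>_def s_def)
  have \<sigma>2: "\<sigma> j * \<sigma> j = 1" for j using \<sigma>[of j] by auto
  have s2: "s j * s j = 1" for j by (simp add: s_def)
  define c where "c j = \<sigma> (Suc j) * d j" for j
  define y where "y j = of_int (\<sigma> j) * x j" for j
  have \<sigma>_Suc: "\<sigma> (Suc j) = \<sigma> j * s j" for j by (simp add: \<sigma>_def)
  have y_Suc: "y (Suc j) = \<beta> * y j + of_int (c j)" for j
  proof -
    have "y (Suc j) = of_int (\<sigma> j * (s j * s j)) * \<beta> * x j + of_int (c j)"
      unfolding y_def x_Suc c_def \<sigma>_Suc of_int_mult by algebra
    then show ?thesis by (simp add: s2 y_def)
  qed
  have y0: "y 0 = 1" by (simp add: y_def \<sigma>_def x_def)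
  define q where "q = horner (\<lambda>j. of_int (c j) :: rat)"
  define Y where "Y j = poly (map_poly of_rat (q j)) z" for j
  have q_Suc: "poly (map_poly of_rat (q (Suc j))) w = w * poly (map_poly of_rat (q j)) w + of_int (c j)"
    for w :: complex and j
    by (simp add: q_def map_poly_pCons)
  have q_beta: "poly (map_poly of_rat (q j)) (of_real \<beta>) = (of_real (y j) :: complex)" for j
  proof (induction j)
    case 0
    show ?case by (simp add: q_def y0)
  next
    case (Suc j)
    then show ?case unfolding q_Suc y_Suc by simp
  qed
  \<comment> \<open>Since \<sigma>_j y_j = x_j, a coincidence of orbit points is a rational relation
    between \<open>q i\<close> and \<open>q j\<close> at \<beta>, and it persists at
    \<open>z\<close>.\<close>
  have rel: "of_int (\<sigma> i) * Y i = of_int (\<sigma> j) * Y j" if "x i = x j" for i j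
  proof -
    define r where "r = smult (of_int (\<sigma> i)) (q i) - smult (of_int (\<sigma> j)) (q j)"
    have ev: "poly (map_poly of_rat r) w = of_int (\<sigma> i) * poly (map_poly of_rat (q i)) w
        - of_int (\<sigma> j) * poly (map_poly of_rat (q j)) w" for w :: complex
    proof -
      have "map_poly of_rat r = (smult (of_int (\<sigma> i)) (map_poly of_rat (q i))
        - smult (of_int (\<sigma> j)) (map_poly of_rat (q j)) :: complex poly)"
        by (rule poly_eqI) (simp add: r_def coeff_map_poly of_rat_diff of_rat_mult)
      then show ?thesis by simp
    qed
    have sy: "of_int (\<sigma> j) * (of_real (y j) :: complex) = of_real (x j)" for j
      using \<sigma>[of j] by (auto simp: y_def)
    have "poly (map_poly of_rat r) (of_real \<beta> :: complex) = 0"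
      unfolding ev q_beta sy that by simp
    then have "poly (map_poly of_rat r) z = 0" by (rule Galois_conjugates_root[OF gc])
    then show ?thesis by (simp add: ev Y_def)
  qed
  have "finite (range (\<lambda>j. of_int (\<sigma> j) * Y j))"
  proof -
    \<comment> \<open>By \<open>rel\<close> the value depends only on the orbit point;
      \<open>g\<close> evaluates it at any index representing that point.\<close>
    define g where "g v = (let j = (SOME j. x j = v) in of_int (\<sigma> j) * Y j)" for v
    have "of_int (\<sigma> j) * Y j = g (x j)" for j
      unfolding g_def Let_def by (rule rel) (metis (mono_tags) someI)
    then have "range (\<lambda>j. of_int (\<sigma> j) * Y j) \<subseteq> g ` range x" by auto
    then show ?thesis using fin finite_surj by auto
  qed
  then have "bounded (range (\<lambda>j. of_int (\<sigma> j) * Y j))" by (rule finite_imp_bounded)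
  then obtain B where "\<forall>v\<in>range (\<lambda>j. of_int (\<sigma> j) * Y j). norm v \<le> B"
    unfolding bounded_iff by blast
  then have B: "norm (of_int (\<sigma> j) * Y j) \<le> B" for j by blast
  have YB: "norm (Y j) \<le> B" for j
    using B[of j] \<sigma>[of j] by (auto simp: norm_mult)
  have y_le: "\<bar>y j\<bar> \<le> 1" for j using \<sigma>[of j] x_range[of j] by (auto simp: y_def)
  show ?thesis
  proof (rule unit_box_root_of_bounded[of y, OF y0 y_le _ t])
    fix n
    have "Y n - of_real (y n) = (z - of_real \<beta>) * (\<Sum>i<n. of_real (y i) * z ^ (n - Suc i))"
      by (rule recurrence_quotient[where c = "\<lambda>j. of_int (c j)"])
        (simp_all add: Y_def q_Suc y_Suc y0, simp add: q_def)
    then have "norm (\<Sum>i<n. of_real (y i) * z ^ (n - Suc i)) = norm (Y n - of_real (y n)) / norm (z - of_real \<beta>)"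
      using zb by (simp add: norm_mult)
    also have "\<dots> \<le> (B + 1) / norm (z - of_real \<beta>)"
      using norm_triangle_ineq4[of "Y n" "of_real (y n)"] YB[of n] y_le[of n]
      by (intro divide_right_mono) auto
    finally show "norm (\<Sum>i<n. of_real (y i) * z ^ (n - Suc i)) \<le> (B + 1) / norm (z - of_real \<beta>)" .
  qed
qed

subsection \<open>Recurrences realized as orbits\<close>

text \<open>For positive \<open>x\<close>, branch k is given by k < \<beta> x \<le> k + 1, so k is
  one less than the ceiling. The point 0 is excluded because branch 0 also contains its left
  endpoint.\<close>

lemma gen_beta_map_ceiling:
  assumes m: "m \<ge> 1" "\<beta> \<in> {real m<..real m + 1}" and x: "0 < x" "x \<le> 1"
  shows "gen_beta_map m \<beta> E x =
    (if E (nat (\<lceil>\<beta> * x\<rceil> - 1)) = 1 then \<beta> * x - of_int \<lceil>\<beta> * x\<rceil> + 1 else of_int \<lceil>\<beta> * x\<rceil> - \<beta> * x)"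
proof -
  define k where "k = nat (\<lceil>\<beta> * x\<rceil> - 1)"
  have b: "\<beta> > 0" using m by auto
  have pos: "\<beta> * x > 0" using b x by simp
  have "\<beta> * x \<le> \<beta> * 1" using b x by (intro mult_left_mono) auto
  then have le: "\<beta> * x \<le> real m + 1"
    using m(2) unfolding greaterThanAtMost_iff by linarith
  have c: "\<lceil>\<beta> * x\<rceil> \<ge> 1" "\<lceil>\<beta> * x\<rceil> \<le> int m + 1" using pos le by linarith+
  have k: "real k = of_int \<lceil>\<beta> * x\<rceil> - 1" using c by (simp add: k_def)
  have "k \<le> m" using c by (simp add: k_def)
  have bd: "real k < \<beta> * x" "\<beta> * x \<le> real k + 1" using k by linarith+
  have "x \<in> branch_interval m \<beta> k"
    using bd b x \<open>k \<le> m\<close> by (auto simp: branch_interval_def field_simps)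
  then show ?thesis
    using gen_beta_map_eq[OF m, of x k E] x \<open>k \<le> m\<close> k by (simp add: k_def[symmetric])
qed

lemma gen_beta_map_0:
  assumes "m \<ge> 1" "\<beta> \<in> {real m<..real m + 1}"
  shows "gen_beta_map m \<beta> E 0 \<in> {0, 1}"
  using gen_beta_map_eq[OF assms, of 0 0 E] assms by (simp add: branch_interval_def)

lemma pcf_if_finite_invariant:
  assumes "finite T" "1 \<in> T" "\<And>x. x \<in> T \<Longrightarrow> f x \<in> T"
  shows "pcf f"
proof -
  have "(f ^^ j) 1 \<in> T" for j by (induction j) (auto intro: assms)
  then have "{(f ^^ j) 1 | j. True} \<subseteq> T" by auto
  then show ?thesis unfolding pcf_def using assms(1) finite_subset by blast
qed

text \<open>By \<open>inj\<close> the values |y_j| lie on distinct branches, so a sign can be chosen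
  for each j separately: -1 exactly when y_j and y_(j+1) have opposite signs. Then |y_j| is mapped
  to |y_(j+1)| for j < n and |y_n| to 1, so the orbit of 1 is periodic.\<close>

lemma generalized_Parry_if_recurrence:
  fixes y :: "nat \<Rightarrow> real" and c :: "nat \<Rightarrow> int"
  assumes \<beta>: "\<beta> > 2" and y0: "y 0 = 1" and yn: "y (Suc n) = 0"
    and rec: "\<And>j. j \<le> n \<Longrightarrow> y (Suc j) = \<beta> * y j + of_int (c j)"
    and y: "\<And>j. 1 \<le> j \<Longrightarrow> j \<le> n \<Longrightarrow> 0 < \<bar>y j\<bar> \<and> \<bar>y j\<bar> < 1"
    and inj: "inj_on (\<lambda>j. \<lceil>\<beta> * \<bar>y j\<bar>\<rceil>) {..n}"
  shows "generalized_Parry \<beta>"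
proof -
  define m where "m = nat (\<lceil>\<beta>\<rceil> - 1)"
  have "real m = of_int \<lceil>\<beta>\<rceil> - 1" using \<beta> by (simp add: m_def)
  then have m: "m \<ge> 1" "\<beta> \<in> {real m<..real m + 1}"
    using \<beta> by (auto simp: m_def) linarith+
  define k where "k j = nat (\<lceil>\<beta> * \<bar>y j\<bar>\<rceil> - 1)" for j
  have ypos: "0 < \<bar>y j\<bar>" "\<bar>y j\<bar> \<le> 1" if "j \<le> n" for j
    using y[of j] y0 that by (cases "j = 0"; force)+
  have injk: "i = j" if "k i = k j" "i \<le> n" "j \<le> n" for i j
  proof -
    have "\<lceil>\<beta> * \<bar>y i\<bar>\<rceil> \<ge> 1" "\<lceil>\<beta> * \<bar>y j\<bar>\<rceil> \<ge> 1"
      using \<beta> ypos that by (simp_all add: one_le_ceiling)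
    then have "\<lceil>\<beta> * \<bar>y i\<bar>\<rceil> = \<lceil>\<beta> * \<bar>y j\<bar>\<rceil>" using that(1) unfolding k_def by linarith
    then show ?thesis using inj that by (auto dest: inj_onD)
  qed
  \<comment> \<open>The sign is 1 on branches without a point |y_j|, and on that of |y_n|, as
    y_(n+1) = 0.\<close>
  define E where "E q = (if \<exists>j\<le>n. k j = q \<and> y j * y (Suc j) < 0 then -1 else (1::int))" for q
  have E: "E (k j) = (if y j * y (Suc j) < 0 then -1 else 1)" if "j \<le> n" for j
    using injk that unfolding E_def by metis
  define T where "T = insert 0 ((\<lambda>j. \<bar>y j\<bar>) ` {..n})"
  have T1: "1 \<in> T" using y0 by (force simp: T_def image_iff)
  have "gen_beta_map m \<beta> E x \<in> T" if xT: "x \<in> T" for x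
  proof (cases "x = 0")
    case True
    have "{0, 1} \<subseteq> T" using T1 by (simp add: T_def)
    then show ?thesis using gen_beta_map_0[OF m, of E] True by blast
  next
    case False
    then obtain j where j: "j \<le> n" "x = \<bar>y j\<bar>" using xT by (auto simp: T_def)
    define f where "f = gen_beta_map m \<beta> E x"
    have fx: "f =
      (if E (k j) = 1 then \<beta> * x - of_int \<lceil>\<beta> * x\<rceil> + 1 else of_int \<lceil>\<beta> * x\<rceil> - \<beta> * x)"
      unfolding f_def using gen_beta_map_ceiling[OF m, of x E] ypos[OF j(1)] j by (simp add: k_def)
    have rj: "\<beta> * y j = y (Suc j) - of_int (c j)" using rec[OF j(1)] by simp
    \<comment> \<open>\<beta> |y_j| equals \<open>N\<close> plus y_(j+1) times the sign of y_j, so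
      the sign pattern decides on which side of \<open>N\<close> it lies.\<close>
    define N where "N = (if y j > 0 then - c j else c j)"
    have "f \<in> T"
    proof (cases "j = n")
      case True
      \<comment> \<open>Here \<open>x\<close> is the right endpoint of its branch, where the
        increasing map takes the value 1 and not 0; this closes the cycle.\<close>
      have "\<beta> * x = of_int N" using rj yn True j ypos(1)[OF j(1)] by (auto simp: N_def abs_if)
      then have "f = 1" using fx E[OF j(1)] yn True by simp
      then show ?thesis using T1 by simp
    next
      case False
      then have y': "0 < \<bar>y (Suc j)\<bar>" "\<bar>y (Suc j)\<bar> < 1" and "Suc j \<le> n"
        using y[of "Suc j"] j by auto
      have "f = \<bar>y (Suc j)\<bar>"
      proof (cases "y j * y (Suc j) < 0")
        case True
        then have eq: "\<beta> * x = of_int N - \<bar>y (Suc j)\<bar>"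
          using rj j by (auto simp: N_def abs_if mult_less_0_iff)
        then have "\<lceil>\<beta> * x\<rceil> = N" using y' by (simp add: ceiling_eq_iff)
        then show ?thesis using fx E[OF j(1)] True eq by simp
      next
        case False
        then have "y j * y (Suc j) > 0"
          using y' ypos(1)[OF j(1)] by (simp add: not_less less_le)
        then have eq: "\<beta> * x = of_int N + \<bar>y (Suc j)\<bar>"
          using rj j by (auto simp: N_def abs_if zero_less_mult_iff)
        then have "\<lceil>\<beta> * x\<rceil> = N + 1" using y' by (simp add: ceiling_eq_iff)
        then show ?thesis using fx E[OF j(1)] False eq by simp
      qed
      then show ?thesis using \<open>Suc j \<le> n\<close> by (auto simp: T_def)
    qed
    then show ?thesis by (simp add: f_def)
  qed
  then have "pcf (gen_beta_map m \<beta> E)"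
    using T1 by (intro pcf_if_finite_invariant[of T]) (auto simp: T_def)
  moreover have "sign_vector m E" by (simp add: sign_vector_def E_def)
  ultimately show ?thesis using m unfolding generalized_Parry_def by blast
qed

subsection \<open>Unit box roots are limits of conjugates\<close>

text \<open>Solves y_(j+1) = \<beta> y_j + c_j backwards from y_(n+1) = 0: the value at
  \<open>i\<close> is y_(n+1-i). In this direction a large \<beta> contracts, so errors stay
  small.\<close>

primrec backward_orbit :: "(nat \<Rightarrow> int) \<Rightarrow> nat \<Rightarrow> real \<Rightarrow> nat \<Rightarrow> real" where
  "backward_orbit c n \<beta> 0 = 0"
| "backward_orbit c n \<beta> (Suc i) = (backward_orbit c n \<beta> i - of_int (c (n - i))) / \<beta>"

lemma continuous_on_backward_orbit:
  "0 \<notin> S \<Longrightarrow> continuous_on S (\<lambda>\<beta>. backward_orbit c n \<beta> i)"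
  by (induction i) (auto intro!: continuous_intros)

lemma finite_positive_lower_bound:
  fixes F :: "real set"
  assumes "finite F" "\<And>x. x \<in> F \<Longrightarrow> x > 0"
  obtains d where "d > 0" "\<forall>x\<in>F. d \<le> x"
  using that[of "Min (insert 1 F)"] assms by auto

text \<open>Rounding -M b_j to an even integer, and at the last index to one that is 2 mod 4, costs
  a bounded amount however large \<open>M\<close> is. The divisibility conditions prepare
  Eisenstein's criterion at 2.\<close>

lemma even_digits_exist:
  fixes b :: "nat \<Rightarrow> real" and M :: int
  assumes "even M" "b 0 = 1" "n \<ge> 1"
  obtains c :: "nat \<Rightarrow> int" where "c 0 = - M" "\<And>j. even (c j)" "\<not> 4 dvd c n"
    "\<And>j. \<bar>of_int (c j) + of_int M * b j\<bar> \<le> 4"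
proof -
  define c where "c j = (if j = 0 then - M else if j = n then - (4 * \<lfloor>of_int M * b n / 4\<rfloor> + 2)
    else - (2 * \<lfloor>of_int M * b j / 2\<rfloor>))" for j
  have "\<bar>of_int (c j) + of_int M * b j\<bar> \<le> 4" for j
  proof -
    consider "j = 0" | "j = n" "j \<noteq> 0" | "j \<noteq> 0" "j \<noteq> n" by blast
    then show ?thesis
    proof cases
      case 1
      then show ?thesis by (simp add: c_def assms)
    next
      case 2
      define v where "v = \<lfloor>of_int M * b n / 4\<rfloor>"
      have "4 * of_int v \<le> of_int M * b n" "of_int M * b n < 4 * of_int v + 4"
        unfolding v_def by linarith+
      moreover have "c j = - (4 * v + 2)" using 2 by (simp add: c_def v_def)
      ultimately show ?thesis using 2 by simp
    next
      case 3
      define v where "v = \<lfloor>of_int M * b j / 2\<rfloor>"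
      have "2 * of_int v \<le> of_int M * b j" "of_int M * b j < 2 * of_int v + 2"
        unfolding v_def by linarith+
      moreover have "c j = - (2 * v)" using 3 by (simp add: c_def v_def)
      ultimately show ?thesis by simp
    qed
  qed
  moreover have "c 0 = - M" by (simp add: c_def)
  moreover have "even (c j)" for j using assms by (simp add: c_def)
  moreover have "\<not> 4 dvd c n"
  proof -
    have "c n = - (4 * \<lfloor>of_int M * b n / 4\<rfloor> + 2)" using assms(3) by (simp add: c_def)
    then show ?thesis by presburger
  qed
  ultimately show thesis using that by blast
qed

text \<open>With \<beta> near a large even \<open>M\<close> and c_j near -M b_j, solving the
  recurrence backwards from 0 gives y_j near b_j. The remaining condition y_0 = 1 is an equation for
  \<beta>, solved by the intermediate value theorem.\<close>

lemma prescribed_orbit: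
  fixes b :: "nat \<Rightarrow> real"
  assumes n: "n \<ge> 1" and b0: "b 0 = 1"
    and b: "\<And>j. 1 \<le> j \<Longrightarrow> j \<le> n \<Longrightarrow> 0 < \<bar>b j\<bar> \<and> \<bar>b j\<bar> < 1"
    and inj: "inj_on (\<lambda>j. \<bar>b j\<bar>) {..n}" and \<epsilon>: "\<epsilon> > 0"
  obtains \<beta> y c where "\<beta> > B" "\<beta> > 2" "y 0 = 1" "y (Suc n) = 0"
    "\<forall>j\<le>n. y (Suc j) = \<beta> * y j + of_int (c j)"
    "\<forall>j. 1 \<le> j \<and> j \<le> n \<longrightarrow> 0 < \<bar>y j\<bar> \<and> \<bar>y j\<bar> < (1::real)"
    "inj_on (\<lambda>j. \<lceil>\<beta> * \<bar>y j\<bar>\<rceil>) {..n}"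
    "\<forall>j\<le>n. \<bar>y j - b j\<bar> < \<epsilon>"
    "\<forall>j. even (c j)" "\<not> 4 dvd (c n :: int)"
proof -
  \<comment> \<open>As \<open>b 0 = 1\<close>, the gaps involving index 0 also keep the other |b_j|
    away from 1.\<close>
  define F where "F = (\<lambda>j. \<bar>b j\<bar>) ` {..n} \<union>
    (\<lambda>(i, j). \<bar>\<bar>b i\<bar> - \<bar>b j\<bar>\<bar>) ` {(i, j) \<in> {..n} \<times> {..n}. i \<noteq> j}"
  have "finite {(i, j) \<in> {..n} \<times> {..n}. i \<noteq> j}"
    by (rule finite_subset[of _ "{..n} \<times> {..n}"]) auto
  then have "finite F" unfolding F_def by blast
  moreover have "x > 0" if "x \<in> F" for x
  proof -
    have "0 < \<bar>b j\<bar>" if "j \<le> n" for j using b[of j] b0 that by (cases "j = 0") auto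
    moreover have "\<bar>\<bar>b i\<bar> - \<bar>b j\<bar>\<bar> > 0" if "i \<le> n" "j \<le> n" "i \<noteq> j" for i j
      using inj_onD[OF inj, of i j] that by auto
    ultimately show ?thesis using that unfolding F_def by auto
  qed
  ultimately obtain \<delta> where \<delta>: "\<delta> > 0" "\<forall>x\<in>F. \<delta> \<le> x"
    by (rule finite_positive_lower_bound)
  have \<delta>_abs: "\<delta> \<le> \<bar>b j\<bar>" if "j \<le> n" for j
    using that by (intro \<delta>(2)[rule_format]) (auto simp: F_def)
  have \<delta>_diff: "\<delta> \<le> \<bar>\<bar>b i\<bar> - \<bar>b j\<bar>\<bar>" if "i \<le> n" "j \<le> n" "i \<noteq> j" for i j
    using that by (intro \<delta>(2)[rule_format]) (force simp: F_def)
  have \<delta>_1: "\<bar>b j\<bar> \<le> 1 - \<delta>" if "1 \<le> j" "j \<le> n" for j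
    using \<delta>_diff[of 0 j] b[of j] b0 that by simp
  \<comment> \<open>With errors below \<delta> / 4, two perturbed absolute values still differ by at
    least \<delta> / 2.\<close>
  define \<eta> where "\<eta> = min \<epsilon> (\<delta> / 4)"
  have \<eta>: "\<eta> > 0" "\<eta> \<le> \<epsilon>" "\<eta> \<le> \<delta> / 4" using \<delta> \<epsilon> by (auto simp: \<eta>_def)
  \<comment> \<open>Every \<beta> considered is at least M - 2. This has to exceed \<open>B\<close>
    and 2, make the error 7 / \<beta> smaller than \<eta>, and make \<beta> \<delta> / 2 exceed 1 so
    that the ceilings differ.\<close>
  define L where "L = \<lceil>max (max \<bar>B\<bar> 2) (max (7 / \<eta>) (2 / \<delta>))\<rceil> + 2"
  define M where "M = 2 * L"
  have "max (max \<bar>B\<bar> 2) (max (7 / \<eta>) (2 / \<delta>)) \<le> of_int L - 2"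
    unfolding L_def by simp
  then have L: "\<bar>B\<bar> \<le> of_int L - 2" "2 \<le> of_int L - (2::real)" "7 / \<eta> \<le> of_int L - 2" "2 / \<delta> \<le> of_int L - 2"
    by auto
  then have M: "B < of_int M - 2" "2 < of_int M - (2::real)" "7 / \<eta> < of_int M - 2" "2 / \<delta> < of_int M - 2"
    unfolding M_def by (auto simp: abs_le_iff)
  have "even M" by (simp add: M_def)
  then obtain c where c: "c 0 = - M" "\<And>j. even (c j)" "\<not> 4 dvd c n"
    "\<And>j. \<bar>of_int (c j) + of_int M * b j\<bar> \<le> 4"
    using even_digits_exist[of M b n, OF _ b0 n] by blast
  define I where "I = {of_int M - 2..of_int M + (2::real)}"
  have G1: "\<bar>backward_orbit c n \<beta> (Suc i) - b (n - i)\<bar> < \<eta>"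
    if "\<beta> \<in> I" "i < n" "\<bar>backward_orbit c n \<beta> i\<bar> \<le> 1" for \<beta> i
  proof -
    have \<beta>: "\<beta> \<ge> of_int M - 2" "\<bar>of_int M - \<beta>\<bar> \<le> 2" using that by (auto simp: I_def)
    then have pos: "\<beta> > 0" using M by linarith
    have b1: "\<bar>b (n - i)\<bar> \<le> 1" using b[of "n - i"] that(2) by (simp add: Suc_leI)
    \<comment> \<open>The three terms are the previous value, the rounding error and the effect of
      replacing \<open>M\<close> by \<beta>, of sizes at most 1, 4 and 2.\<close>
    define v where "v = backward_orbit c n \<beta> i
        - (of_int (c (n - i)) + of_int M * b (n - i)) + (of_int M - \<beta>) * b (n - i)"
    have v: "backward_orbit c n \<beta> (Suc i) - b (n - i) = v / \<beta>"
      using pos by (simp add: v_def field_simps)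
    have "\<bar>(of_int M - \<beta>) * b (n - i)\<bar> \<le> 2 * 1"
      unfolding abs_mult using \<beta>(2) b1 by (intro mult_mono) auto
    then have "\<bar>v\<bar> \<le> 7" using that(3) c(4)[of "n - i"] unfolding v_def by linarith
    then have "\<bar>backward_orbit c n \<beta> (Suc i) - b (n - i)\<bar> \<le> 7 / \<beta>"
      using pos unfolding v by (simp add: abs_divide divide_right_mono)
    also have "\<dots> < \<eta>"
    proof -
      have "7 / \<eta> < \<beta>" using M \<beta> by linarith
      then show ?thesis using pos \<eta>(1) by (simp add: field_simps)
    qed
    finally show ?thesis .
  qed
  have G2: "\<bar>backward_orbit c n \<beta> i\<bar> \<le> 1" if "\<beta> \<in> I" "i \<le> n" for \<beta> i
    using that(2)
  proof (induction i)
    case (Suc i)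
    have "\<bar>backward_orbit c n \<beta> (Suc i) - b (n - i)\<bar> < \<eta>" using Suc by (intro G1[OF that(1)]) auto
    moreover have "\<bar>b (n - i)\<bar> \<le> 1 - \<delta>" using Suc.prems by (intro \<delta>_1) auto
    ultimately show ?case using \<eta> \<delta>(1) by linarith
  qed simp
  \<comment> \<open>Since c_0 = -M, the condition y_0 = 1 means y_1 = \<beta> - M. By
    \<open>G2\<close> the backward value y_1 is at most 1 in size, while \<beta> - M runs from -2 to
    2.\<close>
  have "\<exists>\<beta>\<ge>of_int M - 2. \<beta> \<le> of_int M + 2 \<and> \<beta> - of_int M - backward_orbit c n \<beta> n = 0"
  proof (rule IVT')
    have "0 \<notin> {of_int M - 2..of_int M + (2::real)}" using M by auto
    then show "continuous_on {of_int M - 2..of_int M + 2} (\<lambda>\<beta>. \<beta> - of_int M - backward_orbit c n \<beta> n)"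
      by (intro continuous_intros continuous_on_backward_orbit)
    show "of_int M - 2 - of_int M - backward_orbit c n (of_int M - 2) n \<le> 0"
      using G2[of "of_int M - 2" n] by (simp add: I_def)
    show "0 \<le> of_int M + 2 - of_int M - backward_orbit c n (of_int M + 2) n"
      using G2[of "of_int M + 2" n] by (simp add: I_def)
  qed simp
  then obtain \<beta> where \<beta>I: "\<beta> \<in> I" and \<beta>0: "backward_orbit c n \<beta> n = \<beta> - of_int M"
    by (auto simp: I_def)
  have \<beta>: "\<beta> \<ge> of_int M - 2" using \<beta>I by (simp add: I_def)
  have pos: "\<beta> > 0" using \<beta> M by linarith
  \<comment> \<open>The value at 0 is set by hand; it fits the recurrence by the choice of
    \<beta>.\<close>
  define y where "y j = (if j = 0 then 1 else backward_orbit c n \<beta> (Suc n - j))" for j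
  have yb: "\<bar>y j - b j\<bar> < \<eta>" if "j \<le> n" for j
  proof (cases "j = 0")
    case True
    then show ?thesis using b0 \<eta> by (simp add: y_def)
  next
    case False
    then show ?thesis
      using G1[OF \<beta>I, of "n - j"] G2[OF \<beta>I, of "n - j"] that by (simp add: y_def Suc_diff_le del: backward_orbit.simps)
  qed
  have "\<beta> > B" "\<beta> > 2" using \<beta> M by linarith+
  moreover have "y 0 = 1" "y (Suc n) = 0" by (simp_all add: y_def)
  moreover have "y (Suc j) = \<beta> * y j + of_int (c j)" if "j \<le> n" for j
    using that pos by (cases "j = 0") (auto simp: y_def \<beta>0 c(1) Suc_diff_le)
  moreover have "0 < \<bar>y j\<bar> \<and> \<bar>y j\<bar> < 1" if "1 \<le> j" "j \<le> n" for j
    using yb[OF that(2)] \<delta>_1[OF that] \<delta>_abs[OF that(2)] \<eta> \<delta>(1) by linarith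
  moreover have "inj_on (\<lambda>j. \<lceil>\<beta> * \<bar>y j\<bar>\<rceil>) {..n}"
  proof (rule inj_onI, rule ccontr)
    fix i j assume ij: "i \<in> {..n}" "j \<in> {..n}" "\<lceil>\<beta> * \<bar>y i\<bar>\<rceil> = \<lceil>\<beta> * \<bar>y j\<bar>\<rceil>" "i \<noteq> j"
    have "\<bar>\<bar>y l\<bar> - \<bar>b l\<bar>\<bar> < \<eta>" if "l \<le> n" for l
      using yb[OF that] by linarith
    moreover have "\<bar>u - v\<bar> \<ge> \<delta> / 2" if "\<bar>u - p\<bar> < \<eta>" "\<bar>v - q\<bar> < \<eta>" "\<delta> \<le> \<bar>p - q\<bar>" for u v p q
      using that \<eta>(3) by linarith
    ultimately have "\<bar>\<bar>y i\<bar> - \<bar>y j\<bar>\<bar> \<ge> \<delta> / 2"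
      using \<delta>_diff[of i j] ij(1,2,4) unfolding atMost_iff by blast
    then have "\<beta> * \<bar>\<bar>y i\<bar> - \<bar>y j\<bar>\<bar> \<ge> \<beta> * (\<delta> / 2)" using pos by (intro mult_left_mono) auto
    moreover have "\<beta> * (\<delta> / 2) > 1"
    proof -
      have "2 / \<delta> < \<beta>" using M \<beta> by linarith
      then show ?thesis using \<delta>(1) by (simp add: field_simps)
    qed
    moreover have "\<beta> * \<bar>\<bar>y i\<bar> - \<bar>y j\<bar>\<bar> = \<bar>\<beta> * \<bar>y i\<bar> - \<beta> * \<bar>y j\<bar>\<bar>"
      using pos by (simp add: abs_mult right_diff_distrib[symmetric])
    ultimately have "\<bar>\<beta> * \<bar>y i\<bar> - \<beta> * \<bar>y j\<bar>\<bar> > 1" by linarith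
    then show False using ij(3) by linarith
  qed
  moreover have "\<bar>y j - b j\<bar> < \<epsilon>" if "j \<le> n" for j using yb[OF that] \<eta> by linarith
  ultimately show thesis using c(2,3) by (intro that[of \<beta> y c]) blast+
qed

text \<open>Each new term is taken from a nonempty open interval and has to avoid only 0 and the
  earlier terms up to sign. The result is in the position that \<open>prescribed_orbit\<close>
  requires.\<close>

lemma generic_perturbation:
  fixes a :: "nat \<Rightarrow> real"
  assumes \<epsilon>: "\<epsilon> > 0" and a: "\<And>j. j \<le> n \<Longrightarrow> \<bar>a j\<bar> \<le> 1"
  shows "\<exists>b. b 0 = 1 \<and> (\<forall>j. 1 \<le> j \<and> j \<le> n \<longrightarrow> 0 < \<bar>b j\<bar> \<and> \<bar>b j\<bar> < 1 \<and> \<bar>b j - a j\<bar> < \<epsilon>) \<and>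
    inj_on (\<lambda>j. \<bar>b j\<bar>) {..n}"
  using a
proof (induction n)
  case 0
  show ?case by (intro exI[of _ "\<lambda>_. 1"]) auto
next
  case (Suc n)
  then obtain b where b: "b 0 = 1" "inj_on (\<lambda>j. \<bar>b j\<bar>) {..n}"
    "\<And>j. 1 \<le> j \<Longrightarrow> j \<le> n \<Longrightarrow> 0 < \<bar>b j\<bar> \<and> \<bar>b j\<bar> < 1 \<and> \<bar>b j - a j\<bar> < \<epsilon>"
    by (metis le_SucI)
  define l u where "l = max (-1) (a (Suc n) - \<epsilon>)" and "u = min 1 (a (Suc n) + \<epsilon>)"
  have "l < u" using Suc.prems[of "Suc n"] \<epsilon> by (auto simp: l_def u_def)
  then have "infinite {l<..<u}" by (rule infinite_Ioo)
  moreover have "finite (insert 0 (b ` {..n} \<union> (\<lambda>j. - b j) ` {..n}))" by auto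
  ultimately obtain v where v: "v \<in> {l<..<u}" "v \<notin> insert 0 (b ` {..n} \<union> (\<lambda>j. - b j) ` {..n})"
    by (meson finite_subset subsetI)
  have v_bd: "0 < \<bar>v\<bar>" "\<bar>v\<bar> < 1" "\<bar>v - a (Suc n)\<bar> < \<epsilon>" using v by (auto simp: l_def u_def)
  have v_ne: "\<bar>b j\<bar> \<noteq> \<bar>v\<bar>" if "j \<le> n" for j
  proof -
    have "v \<noteq> b j" "v \<noteq> - b j" using v(2) that by auto
    then show ?thesis by linarith
  qed
  show ?case
  proof (intro exI[of _ "b(Suc n := v)"] conjI allI impI)
    show "inj_on (\<lambda>j. \<bar>(b(Suc n := v)) j\<bar>) {..Suc n}"
      using b(2) v_ne unfolding atMost_Suc
      by (auto simp: inj_on_def v_ne v_ne[symmetric])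
  qed (use b v_bd le_Suc_eq in auto)
qed

lemma unit_box_root_in_closure_Omega:
  assumes "unit_box_root z"
  shows "z \<in> closure Omega"
  unfolding closure_approachable
proof (intro allI impI)
  fix e :: real assume e: "e > 0"
  obtain n a where a0: "a 0 = 1" and a: "\<And>j. j \<le> n \<Longrightarrow> \<bar>a j\<bar> \<le> 1"
    and root: "(\<Sum>j\<le>n. of_real (a j) * z ^ (n - j)) = 0"
    using assms by (auto simp: unit_box_root_def)
  have n: "n \<ge> 1" using root a0 by (cases n) auto
  define W where "W = (\<Sum>j\<le>n. norm z ^ (n - j))"
  have "W \<ge> 0" by (simp add: W_def sum_nonneg)
  \<comment> \<open>Each coefficient moves by at most 2 \<epsilon>, once for genericity and once for
    the orbit; the value at \<open>z\<close> then moves by less than \<open>e ^ n\<close>.\<close>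
  define \<epsilon> where "\<epsilon> = e ^ n / (2 * (W + 1))"
  have \<epsilon>: "\<epsilon> > 0" using e \<open>W \<ge> 0\<close> by (simp add: \<epsilon>_def)
  have "2 * \<epsilon> * W < e ^ n"
    using e \<open>W \<ge> 0\<close> by (simp add: \<epsilon>_def field_simps)
  obtain b where b: "b 0 = 1" "inj_on (\<lambda>j. \<bar>b j\<bar>) {..n}"
    "\<And>j. 1 \<le> j \<Longrightarrow> j \<le> n \<Longrightarrow> 0 < \<bar>b j\<bar> \<and> \<bar>b j\<bar> < 1"
    "\<And>j. 1 \<le> j \<Longrightarrow> j \<le> n \<Longrightarrow> \<bar>b j - a j\<bar> < \<epsilon>"
    using generic_perturbation[of \<epsilon> n a, OF \<epsilon> a] by blast
  \<comment> \<open>The lower bound \<open>norm z + e\<close> keeps \<beta> apart from the root that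
    will be found within \<open>e\<close> of \<open>z\<close>.\<close>
  obtain \<beta> y c where *: "\<beta> > norm z + e" "\<beta> > 2" "y 0 = 1" "y (Suc n) = 0"
    and rec: "\<forall>j\<le>n. y (Suc j) = \<beta> * y j + of_int (c j)"
    and y: "\<forall>j. 1 \<le> j \<and> j \<le> n \<longrightarrow> 0 < \<bar>y j\<bar> \<and> \<bar>y j\<bar> < (1::real)"
    and inj: "inj_on (\<lambda>j. \<lceil>\<beta> * \<bar>y j\<bar>\<rceil>) {..n}"
    and yb: "\<forall>j\<le>n. \<bar>y j - b j\<bar> < \<epsilon>"
    and c: "\<forall>j. even (c j)" "\<not> 4 dvd (c n :: int)"
    by (rule prescribed_orbit[OF n b(1,3,2) \<epsilon>, of "norm z + e"])
  have parry: "generalized_Parry \<beta>"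
    using rec y by (intro generalized_Parry_if_recurrence[OF *(2,3,4) _ _ inj]) auto
  define Q where "Q = horner c (Suc n)"
  \<comment> \<open>\<open>R\<close> is the cofactor of X - \<beta> in \<open>Q\<close>. The index
    is shifted because \<open>horner\<close> itself supplies the leading coefficient 1 =
    y_0.\<close>
  define R where "R = horner (\<lambda>j. of_real (y (Suc j)) :: complex) n"
  have R_eq: "poly R w = (\<Sum>j\<le>n. of_real (y j) * w ^ (n - j))" for w
    unfolding R_def poly_horner_sum by (simp add: lessThan_Suc_atMost[symmetric] sum.lessThan_Suc_shift *(3) del: sum.lessThan_Suc)
  have Q_eq: "poly (map_poly of_int Q) w = (w - of_real \<beta>) * poly R w" for w
  proof -
    define h where "h j = poly (map_poly of_int (horner c j)) w" for j
    have "h (Suc n) - of_real (y (Suc n)) = (w - of_real \<beta>) * (\<Sum>i<Suc n. of_real (y i) * w ^ (Suc n - Suc i))"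
      by (rule recurrence_quotient[where c = "\<lambda>j. of_int (c j)"])
        (simp_all add: h_def map_poly_pCons *(3) rec)
    then show ?thesis
      by (simp add: h_def Q_def *(4) R_eq lessThan_Suc_atMost del: horner.simps)
  qed
  have min: "is_minimal_poly (map_poly of_int Q) (of_real \<beta>)"
  proof (rule eisenstein_minimal_poly[of 2])
    show "lead_coeff Q = 1" unfolding Q_def using horner_monic by blast
    show "2 dvd coeff Q i" if "i < degree Q" for i
      using that spec[OF c(1)] coeff_horner[of i "Suc n" c] horner_monic[of c "Suc n"] unfolding Q_def by simp
    show "\<not> 2\<^sup>2 dvd coeff Q 0" using c(2) by (simp add: Q_def)
    show "poly (map_poly of_int Q) (of_real \<beta> :: complex) = 0" by (simp add: Q_eq)
  qed simp
  have "norm (poly R z) < e ^ n"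
  proof -
    have "poly R z = (\<Sum>j\<le>n. of_real (y j - a j) * z ^ (n - j))"
      using root by (simp add: R_eq left_diff_distrib sum_subtractf)
    also have "norm \<dots> \<le> (\<Sum>j\<le>n. 2 * \<epsilon> * norm z ^ (n - j))"
    proof (rule sum_norm_le)
      fix j assume j: "j \<in> {..n}"
      have "\<bar>y j - a j\<bar> \<le> 2 * \<epsilon>"
        using spec[OF yb, of j] b(4)[of j] *(3) a0 \<epsilon> j by (cases "j = 0") auto
      then show "norm (of_real (y j - a j) * z ^ (n - j)) \<le> 2 * \<epsilon> * norm z ^ (n - j)"
        unfolding norm_mult norm_power norm_of_real by (intro mult_right_mono) auto
    qed
    also have "\<dots> = 2 * \<epsilon> * W" by (simp add: W_def sum_distrib_left)
    finally show ?thesis using \<open>2 * \<epsilon> * W < e ^ n\<close> by simp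
  qed
  moreover have "degree R = n" "lead_coeff R = 1" unfolding R_def using horner_monic by blast+
  ultimately obtain r where r: "poly R r = 0" "dist r z < e"
    using monic_root_near[of R e z] n e by auto
  have "norm r < norm z + e"
    using r(2) norm_triangle_sub[of r z] by (simp add: dist_norm)
  then have "norm r < \<beta>" using *(1) by simp
  then have "r \<noteq> of_real \<beta>" using *(2) by auto
  moreover have "poly (map_poly of_rat (map_poly of_int Q)) r = 0"
    using r(1) by (simp add: map_poly_map_poly o_def Q_eq)
  ultimately have "r \<in> Galois_conjugates (of_real \<beta>)"
    unfolding Galois_conjugates_def using min by blast
  then have "r \<in> Omega" unfolding Omega_def using parry by blast
  then show "\<exists>w\<in>Omega. dist w z < e" using r(2) by blast
qed

section \<open>Star-shapedness of the closure about 0\<close>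

theorem mainTheorem4:
  shows "path_connected (closure Omega)"
proof (cases "Omega = {}")
  case True
  then show ?thesis by simp
next
  case False
  \<comment> \<open>Scaled points of \<open>Omega\<close> are unit box roots and hence lie in the
    closure; continuity of the scaling extends this to limit points.\<close>
  have scale: "of_real t * z \<in> closure Omega" if "z \<in> closure Omega" "0 < t" "t < 1" for t z
  proof -
    have "(\<lambda>z. of_real t * z) ` closure Omega \<subseteq> closure ((\<lambda>z. of_real t * z) ` Omega)"
      by (intro closure_bounded_linear_image_subset bounded_linear_mult_right)
    also have "\<dots> \<subseteq> closure (closure Omega)"
      using Omega_scaled that unit_box_root_in_closure_Omega by (intro closure_mono) auto
    finally show ?thesis using that by auto
  qed
  have zero: "0 \<in> closure Omega"
  proof -
    obtain z where z: "z \<in> closure Omega" using False closure_subset by blast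
    \<comment> \<open>The factors 1 / (n + 2) lie strictly between 0 and 1, as \<open>scale\<close>
      demands, and tend to 0.\<close>
    have "(\<lambda>n. of_real (inverse (real (Suc (Suc n)))) * z) \<longlonglongrightarrow> of_real 0 * z"
      by (intro tendsto_intros LIMSEQ_Suc[OF LIMSEQ_inverse_real_of_nat])
    moreover have "of_real (inverse (real (Suc (Suc n)))) * z \<in> closure Omega" for n
      by (intro scale z) (auto simp: field_simps)
    ultimately have "of_real 0 * z \<in> closure Omega"
      by (rule closed_sequentially[OF closed_closure, rotated])
    then show ?thesis by simp
  qed
  have "closed_segment 0 z \<subseteq> closure Omega" if z: "z \<in> closure Omega" for z
  proof
    fix w assume "w \<in> closed_segment 0 z"
    then obtain t where "0 \<le> t" "t \<le> 1" "w = (1 - t) *\<^sub>R 0 + t *\<^sub>R z"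
      unfolding in_segment by blast
    then have t: "0 \<le> t" "t \<le> 1" "w = of_real t * z" by (simp_all add: scaleR_conv_of_real)
    then consider "t = 0" | "t = 1" | "0 < t" "t < 1" by linarith
    then show "w \<in> closure Omega" using t zero z scale by cases auto
  qed
  then show ?thesis using zero by (intro starlike_imp_path_connected) (auto simp: starlike_def)
qed

end
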